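(* Define the sequence $\{u_n\}_{n=0,1,\ldots}$ by $u_n=0$ if $k!\le n<2\cdot k!$ for some $k\in\{1,2,\ldots\}$, and $u_n=1$ otherwise. Then the lower and upper Ces\`aro limits $\underline{C},\overline{C}$ and the lower and upper Abel limits $\underline{A},\overline{A}$ of $\{u_n\}$ satisfy $$\underline{C}=\tfrac12,\qquad \underline{A}=\tfrac34,\qquad \overline{C}=\overline{A}=1;$$ in particular $\underline{C}<\underline{A}<\overline{A}=\overline{C}$.
   Context: For a real sequence $\{u_n\}_{n=0,1,\ldots}$, the lower and upper Ces\`aro limits are $$\underline{C}=\liminf_{n\to\infty}\frac1n\sum_{i=0}^{n-1}u_i,\qquad \overline{C}=\limsup_{n\to\infty}\frac1n\sum_{i=0}^{n-1}u_i,$$ and the lower and upper Abel limits are $$\underline{A}=\liminf_{\alpha\to1-}(1-\alpha)\sum_{n=0}^\infty u_n\alpha^n,\qquad \overline{A}=\limsup_{\alpha\to1-}(1-\alpha)\sum_{n=0}^\infty u_n\alpha^n,$$ where $\alpha\to 1-$ means $\alpha\in[0,1)$ tends to $1$ from below. *)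

theory Defs
  imports "HOL-Library.Liminf_Limsup" "HOL-Library.Extended_Real" Complex_Main
begin

text \<open>Lower and upper limits are taken in the extended reals, so that they exist for every real
  sequence. The term for \<open>n = 0\<close> is \<open>0\<close> and is irrelevant for the limits.\<close>

definition lower_cesaro :: "(nat \<Rightarrow> real) \<Rightarrow> ereal" where
  "lower_cesaro u = liminf (\<lambda>n. ereal (1 / real n * (\<Sum>i<n. u i)))"

definition upper_cesaro :: "(nat \<Rightarrow> real) \<Rightarrow> ereal" where
  "upper_cesaro u = limsup (\<lambda>n. ereal (1 / real n * (\<Sum>i<n. u i)))"

text \<open>These are meaningful when the power series converges on \<open>[0, 1)\<close>, e.g. for bounded \<open>u\<close>; see
  \<open>summable_abel\<close> below.\<close>

definition lower_abel :: "(nat \<Rightarrow> real) \<Rightarrow> ereal" where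
  "lower_abel u = Liminf (at 1 within {0..<1}) (\<lambda>\<alpha>. ereal ((1 - \<alpha>) * (\<Sum>n. u n * \<alpha> ^ n)))"

definition upper_abel :: "(nat \<Rightarrow> real) \<Rightarrow> ereal" where
  "upper_abel u = Limsup (at 1 within {0..<1}) (\<lambda>\<alpha>. ereal ((1 - \<alpha>) * (\<Sum>n. u n * \<alpha> ^ n)))"

lemma summable_abel:
  fixes u :: "nat \<Rightarrow> real" and \<alpha> :: real
  assumes "\<And>n. \<bar>u n\<bar> \<le> B" and "\<alpha> \<in> {0..<1}"
  shows "summable (\<lambda>n. u n * \<alpha> ^ n)"
proof (rule summable_comparison_test)
  show "\<exists>N. \<forall>n\<ge>N. norm (u n * \<alpha> ^ n) \<le> B * \<alpha> ^ n"
    using assms by (auto simp: abs_mult intro!: mult_right_mono)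
  show "summable (\<lambda>n. B * \<alpha> ^ n)"
    using assms(2) by (intro summable_mult summable_geometric) auto
qed

definition factorial_block_seq :: "nat \<Rightarrow> real" where
  "factorial_block_seq n = (if \<exists>k::nat\<ge>1. fact k \<le> n \<and> n < 2 * fact k then 0 else 1)"

end

theory Submission imports Defs begin

text \<open>
  For every \<open>k \<ge> 1\<close> the sequence dominates the step function that is \<open>1\<close> exactly on
  \<open>[2 k!, (k+1)!)\<close> and \<open>[2 (k+1)!, (k+2)!)\<close> and is dominated by the one that is \<open>0\<close> exactly on
  \<open>[k!, 2 k!)\<close>. Both kinds of mean are monotone and explicit on step functions. With
  \<open>x = \<alpha> ^ (k+1)!\<close> the Abel mean is bounded below by \<open>\<alpha> ^ (2 k!) - x + x\<^sup>2 - \<alpha> ^ (k+2)!\<close>, where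
  \<open>x\<^sup>2 - x \<ge> -1/4\<close>. If \<open>k\<close> is chosen so that \<open>L / (1 - \<alpha>)\<close> lies between \<open>(k+1)!\<close> and \<open>(k+2)!\<close>
  for a large constant \<open>L\<close>, the first term is near \<open>1\<close> and the last near \<open>0\<close>. The value \<open>3/4\<close> is
  approached at \<open>\<alpha> = (1/2) powr (1 / (k+1)!)\<close>, where \<open>x = 1/2\<close>;
  the value \<open>1\<close> at \<open>\<alpha> = 1 - L / (k+1)!\<close>. For the partial sums the same bounds are used at
  \<open>n = 2 k!\<close> and \<open>n = (k+1)!\<close>.
\<close>

section \<open>Epsilon criteria for limits inferior and superior\<close>

lemma Liminf_ereal_eqI:
  fixes f :: "'a \<Rightarrow> real"
  assumes lower: "\<And>e. e > 0 \<Longrightarrow> \<forall>\<^sub>F x in F. c - e \<le> f x"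
    and upper: "\<And>e. e > 0 \<Longrightarrow> \<exists>\<^sub>F x in F. f x \<le> c + e"
  shows "Liminf F (\<lambda>x. ereal (f x)) = ereal c"
proof (rule antisym)
  show "ereal c \<le> Liminf F (\<lambda>x. ereal (f x))"
  proof (rule ereal_le_epsilon2)
    fix e :: real assume "0 < e"
    then have "ereal (c - e) \<le> Liminf F (\<lambda>x. ereal (f x))"
      using lower by (intro Liminf_bounded) auto
    then have "ereal (c - e) + ereal e \<le> Liminf F (\<lambda>x. ereal (f x)) + ereal e"
      by (rule add_right_mono)
    then show "ereal c \<le> Liminf F (\<lambda>x. ereal (f x)) + ereal e" by simp
  qed
  show "Liminf F (\<lambda>x. ereal (f x)) \<le> ereal c"
  proof (rule ereal_le_epsilon2)
    fix e :: real assume e: "0 < e"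
    show "Liminf F (\<lambda>x. ereal (f x)) \<le> ereal c + ereal e"
    proof (rule ccontr)
      assume "\<not> ?thesis"
      then have "\<forall>\<^sub>F x in F. ereal (c + e) < ereal (f x)"
        by (intro less_LiminfD) auto
      then have "\<forall>\<^sub>F x in F. \<not> f x \<le> c + e"
        by (rule eventually_mono) auto
      then show False using upper[OF e] by (simp add: frequently_def)
    qed
  qed
qed

lemma Limsup_ereal_eqI:
  fixes f :: "'a \<Rightarrow> real"
  assumes upper: "\<And>e. e > 0 \<Longrightarrow> \<forall>\<^sub>F x in F. f x \<le> c + e"
    and lower: "\<And>e. e > 0 \<Longrightarrow> \<exists>\<^sub>F x in F. c - e \<le> f x"
  shows "Limsup F (\<lambda>x. ereal (f x)) = ereal c"
proof -
  \<comment> \<open>Passing to \<open>- f\<close> swaps the two hypotheses and reduces the claim to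
    the criterion for \<open>Liminf\<close>.\<close>
  have "Liminf F (\<lambda>x. ereal (- f x)) = ereal (- c)"
  proof (rule Liminf_ereal_eqI)
    fix e :: real assume e: "e > 0"
    show "\<forall>\<^sub>F x in F. - c - e \<le> - f x"
      using upper[OF e] by (rule eventually_mono) auto
    show "\<exists>\<^sub>F x in F. - f x \<le> - c + e"
      using lower[OF e] by (rule frequently_elim1) auto
  qed
  then show ?thesis
    using ereal_Liminf_uminus[of F "\<lambda>x. ereal (f x)"]
    by (cases "Limsup F (\<lambda>x. ereal (f x))") auto
qed

text \<open>Supplies the "frequently" hypotheses of the two criteria: extremal values of the means
  are exhibited only along explicit sequences indexed by \<open>k\<close>.\<close>

lemma frequently_filterlim_sequentially:
  assumes "filterlim x F sequentially" and "\<forall>\<^sub>F k in sequentially. P (x k)"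
  shows "\<exists>\<^sub>F y in F. P y"
proof (rule ccontr)
  assume "\<not> ?thesis"
  then have "\<forall>\<^sub>F k in sequentially. \<not> P (x k)"
    using assms(1) by (auto simp: frequently_def filterlim_iff)
  with assms(2) have "\<forall>\<^sub>F k::nat in sequentially. False"
    by eventually_elim simp
  then show False by simp
qed

section \<open>Growth of factorials\<close>

lemma filterlim_fact_at_top: "filterlim (fact :: nat \<Rightarrow> nat) at_top sequentially"
  by (rule filterlim_at_top_mono[OF filterlim_ident]) (simp add: fact_ge_self)

text \<open>If \<open>m\<close> is least with \<open>y < fact m\<close>, then
  \<open>k = m - 2\<close> works, and \<open>fact k = fact (Suc k) / (k + 1)\<close> gives the last
  bound. It makes \<open>fact k\<close> negligible against \<open>y\<close>, for
  \<open>y = L / (1 - x)\<close> and for \<open>y = n\<close>.\<close>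

lemma between_factorials:
  fixes y :: real
  assumes "fact (Suc N) \<le> y"
  obtains k where "k \<ge> N" "fact (Suc k) \<le> y" "y < fact (Suc (Suc k))" "fact k \<le> y / (N + 1)"
proof -
  define m where "m = (LEAST m::nat. y < fact m)"
  have "y < fact (Suc (nat \<lceil>y\<rceil>))"
  proof -
    have "y < real (Suc (nat \<lceil>y\<rceil>))" by linarith
    also have "\<dots> \<le> real (fact (Suc (nat \<lceil>y\<rceil>)))" using fact_ge_self of_nat_mono by blast
    finally show ?thesis by (simp only: of_nat_fact)
  qed
  then have m: "y < fact m" unfolding m_def by (rule LeastI)
  have less: "fact j \<le> y" if "j < m" for j
    using not_less_Least that unfolding m_def by force
  have "Suc N < m"
  proof (rule ccontr)
    assume "\<not> ?thesis"
    then have "(fact m :: real) \<le> fact (Suc N)" by (intro fact_mono) auto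
    with m assms show False by linarith
  qed
  then obtain k where k: "m = Suc (Suc k)" "k \<ge> N"
    by (metis Suc_le_eq less_Suc_eq_le not0_implies_Suc not_less0 Suc_less_eq)
  have y: "fact (Suc k) \<le> y" using less[of "Suc k"] k by (simp del: fact_Suc)
  have "fact k * (real N + 1) \<le> fact k * (real k + 1)"
    using k by (intro mult_left_mono) auto
  also have "\<dots> = fact (Suc k)" by (simp add: algebra_simps)
  also note y
  finally have "fact k \<le> y / (N + 1)" by (simp add: field_simps)
  with that k y m show thesis by blast
qed

lemma double_fact_le: "k \<ge> 1 \<Longrightarrow> 2 * fact k \<le> (fact (Suc k) :: nat)"
  by simp

section \<open>Step functions bounding the sequence, and their sums\<close>

lemma factorial_block_seq_le_1: "factorial_block_seq n \<le> 1"
  and factorial_block_seq_nonneg: "0 \<le> factorial_block_seq n"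
  by (auto simp: factorial_block_seq_def)

text \<open>Zero blocks with index \<open>j \<le> k\<close> end by \<open>2 * fact k\<close>; those
  with \<open>j > k\<close> start no earlier than \<open>fact (Suc k)\<close>.\<close>

lemma factorial_block_seq_eq_1:
  assumes "2 * fact k \<le> n" "n < fact (Suc k)"
  shows "factorial_block_seq n = 1"
proof -
  have False if "fact j \<le> n" "n < 2 * fact j" for j :: nat
  proof (cases "j \<le> k")
    case True
    then have "(fact j :: nat) \<le> fact k" by (rule fact_mono)
    with that assms show False by linarith
  next
    case False
    then have "(fact (Suc k) :: nat) \<le> fact j" by (intro fact_mono) auto
    with that assms show False by linarith
  qed
  then show ?thesis by (auto simp: factorial_block_seq_def)
qed

text \<open>Step functions are written as signed sums of indicators of half-lines
  \<open>a \<le> n\<close>, whose partial sums and power series have closed forms. For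
  \<open>k \<ge> 1\<close> the difference takes only the values 0 and 1, as
  \<open>2 * fact k \<le> fact (Suc k)\<close>.\<close>

lemma factorial_block_seq_ge_1_step:
  assumes "k \<ge> 1"
  shows "of_bool (2 * fact k \<le> n) - of_bool (fact (Suc k) \<le> n) \<le> factorial_block_seq n"
  using factorial_block_seq_eq_1[of k n] factorial_block_seq_nonneg[of n] double_fact_le[OF assms]
  by (auto simp: of_bool_def simp del: fact_Suc)

lemma factorial_block_seq_ge_2_steps:
  assumes "k \<ge> 1"
  shows "of_bool (2 * fact k \<le> n) - of_bool (fact (Suc k) \<le> n)
    + of_bool (2 * fact (Suc k) \<le> n) - of_bool (fact (Suc (Suc k)) \<le> n) \<le> factorial_block_seq n"
  using factorial_block_seq_eq_1[of k n] factorial_block_seq_eq_1[of "Suc k" n]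
    factorial_block_seq_nonneg[of n] double_fact_le[OF assms] double_fact_le[of "Suc k"]
  by (auto simp: of_bool_def simp del: fact_Suc)

lemma factorial_block_seq_le_step:
  assumes "k \<ge> 1"
  shows "factorial_block_seq n \<le> 1 - of_bool (fact k \<le> n) + of_bool (2 * fact k \<le> n)"
  using assms by (auto simp: factorial_block_seq_def of_bool_def)

text \<open>Truncated subtraction yields the correct value 0 when \<open>n < a\<close>.\<close>

lemma sum_of_bool_le:
  "(\<Sum>i<n. of_bool (a \<le> i)) = real (n - a)"
  by (induction n) (auto simp: Suc_diff_le of_bool_def)

text \<open>This is the geometric series shifted by \<open>a\<close>, so the Abel mean of a
  half-line indicator is \<open>x ^ a\<close>.\<close>

lemma sums_of_bool_le_geometric:
  fixes x :: real
  assumes "x \<in> {0..<1}"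
  shows "(\<lambda>n. of_bool (a \<le> n) * x ^ n) sums (x ^ a / (1 - x))"
proof -
  have "(\<lambda>n. x ^ a * x ^ n) sums (x ^ a * (1 / (1 - x)))"
    using assms by (intro sums_mult geometric_sums) auto
  then have "(\<lambda>n. of_bool (a \<le> n + a) * x ^ (n + a)) sums (x ^ a / (1 - x))"
    by (simp add: power_add mult.commute)
  then show ?thesis
    by (subst (asm) sums_zero_iff_shift) auto
qed

section \<open>Bounds on the Abel mean\<close>

definition abel_mean :: "real \<Rightarrow> real" where
  "abel_mean x = (1 - x) * (\<Sum>n. factorial_block_seq n * x ^ n)"

text \<open>The comparison series has its sum in the form \<open>s / (1 - x)\<close> so that
  \<open>s\<close> is its Abel mean.\<close>

lemma abel_mean_ge:
  assumes x: "x \<in> {0..<1}" and g: "g sums (s / (1 - x))"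
    and le: "\<And>n. g n \<le> factorial_block_seq n * x ^ n"
  shows "s \<le> abel_mean x"
proof -
  have "s / (1 - x) \<le> (\<Sum>n. factorial_block_seq n * x ^ n)"
    unfolding sums_unique[OF g]
    using factorial_block_seq_le_1 factorial_block_seq_nonneg
    by (intro suminf_le le sums_summable[OF g] summable_abel[OF _ x, where B = 1]) auto
  with x show ?thesis by (simp add: abel_mean_def field_simps)
qed

lemma abel_mean_le:
  assumes x: "x \<in> {0..<1}" and g: "g sums (s / (1 - x))"
    and le: "\<And>n. factorial_block_seq n * x ^ n \<le> g n"
  shows "abel_mean x \<le> s"
proof -
  have "(\<Sum>n. factorial_block_seq n * x ^ n) \<le> s / (1 - x)"
    unfolding sums_unique[OF g]
    using factorial_block_seq_le_1 factorial_block_seq_nonneg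
    by (intro suminf_le le sums_summable[OF g] summable_abel[OF _ x, where B = 1]) auto
  with x show ?thesis by (simp add: abel_mean_def field_simps)
qed

lemma abel_mean_le_1:
  assumes x: "x \<in> {0..<1}"
  shows "abel_mean x \<le> 1"
proof (rule abel_mean_le[OF x])
  show "(\<lambda>n. x ^ n) sums (1 / (1 - x))" using x by (intro geometric_sums) auto
  show "factorial_block_seq n * x ^ n \<le> x ^ n" for n
    using x by (intro mult_left_le_one_le factorial_block_seq_le_1 factorial_block_seq_nonneg) auto
qed

text \<open>With \<open>t = x ^ fact k\<close> the bound reads \<open>1 - t + t^2\<close>, which is
  least at \<open>t = 1/2\<close>, with value 3/4.\<close>

lemma abel_mean_le_step:
  assumes x: "x \<in> {0..<1}" and k: "k \<ge> 1"
  shows "abel_mean x \<le> 1 - x ^ fact k + x ^ (2 * fact k)"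
proof (rule abel_mean_le[OF x])
  let ?h = "\<lambda>a n. of_bool (a \<le> n) * x ^ n"
  have "(\<lambda>n. x ^ n - ?h (fact k) n + ?h (2 * fact k) n) sums
      (1 / (1 - x) - x ^ fact k / (1 - x) + x ^ (2 * fact k) / (1 - x))"
    using x by (intro sums_add sums_diff sums_of_bool_le_geometric geometric_sums) auto
  then show "(\<lambda>n. (1 - of_bool (fact k \<le> n) + of_bool (2 * fact k \<le> n)) * x ^ n) sums
      ((1 - x ^ fact k + x ^ (2 * fact k)) / (1 - x))"
    by (simp add: algebra_simps add_divide_distrib diff_divide_distrib)
  show "factorial_block_seq n * x ^ n
      \<le> (1 - of_bool (fact k \<le> n) + of_bool (2 * fact k \<le> n)) * x ^ n" for n
    using x by (intro mult_right_mono factorial_block_seq_le_step k) auto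
qed

lemma abel_mean_ge_1_step:
  assumes x: "x \<in> {0..<1}" and k: "k \<ge> 1"
  shows "x ^ (2 * fact k) - x ^ fact (Suc k) \<le> abel_mean x"
proof (rule abel_mean_ge[OF x])
  let ?h = "\<lambda>a n. of_bool (a \<le> n) * x ^ n"
  have "(\<lambda>n. ?h (2 * fact k) n - ?h (fact (Suc k)) n) sums
      (x ^ (2 * fact k) / (1 - x) - x ^ fact (Suc k) / (1 - x))"
    using x by (intro sums_diff sums_of_bool_le_geometric) auto
  then show "(\<lambda>n. (of_bool (2 * fact k \<le> n) - of_bool (fact (Suc k) \<le> n)) * x ^ n) sums
      ((x ^ (2 * fact k) - x ^ fact (Suc k)) / (1 - x))"
    by (simp add: algebra_simps diff_divide_distrib del: fact_Suc)
  show "(of_bool (2 * fact k \<le> n) - of_bool (fact (Suc k) \<le> n)) * x ^ n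
      \<le> factorial_block_seq n * x ^ n" for n
    using x by (intro mult_right_mono factorial_block_seq_ge_1_step k) auto
qed

text \<open>The gaps on both sides of the zero block at \<open>fact (Suc k)\<close> are kept: when
  \<open>x ^ fact (Suc k)\<close> is 1/2 and the outer terms are near 1 and 0, the first contributes
  about 1/2 and the second about 1/4.\<close>

lemma abel_mean_ge_2_steps:
  assumes x: "x \<in> {0..<1}" and k: "k \<ge> 1"
  shows "x ^ (2 * fact k) - x ^ fact (Suc k) + x ^ (2 * fact (Suc k)) - x ^ fact (Suc (Suc k))
    \<le> abel_mean x"
proof (rule abel_mean_ge[OF x])
  let ?h = "\<lambda>a n. of_bool (a \<le> n) * x ^ n"
  have "(\<lambda>n. ?h (2 * fact k) n - ?h (fact (Suc k)) n
        + ?h (2 * fact (Suc k)) n - ?h (fact (Suc (Suc k))) n) sums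
      (x ^ (2 * fact k) / (1 - x) - x ^ fact (Suc k) / (1 - x)
        + x ^ (2 * fact (Suc k)) / (1 - x) - x ^ fact (Suc (Suc k)) / (1 - x))"
    using x by (intro sums_add sums_diff sums_of_bool_le_geometric) auto
  then show "(\<lambda>n. (of_bool (2 * fact k \<le> n) - of_bool (fact (Suc k) \<le> n)
        + of_bool (2 * fact (Suc k) \<le> n) - of_bool (fact (Suc (Suc k)) \<le> n)) * x ^ n) sums
      ((x ^ (2 * fact k) - x ^ fact (Suc k) + x ^ (2 * fact (Suc k)) - x ^ fact (Suc (Suc k)))
        / (1 - x))"
    by (simp only: left_diff_distrib distrib_right add_divide_distrib diff_divide_distrib)
  show "(of_bool (2 * fact k \<le> n) - of_bool (fact (Suc k) \<le> n)
        + of_bool (2 * fact (Suc k) \<le> n) - of_bool (fact (Suc (Suc k)) \<le> n)) * x ^ n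
      \<le> factorial_block_seq n * x ^ n" for n
    using x by (intro mult_right_mono factorial_block_seq_ge_2_steps k) auto
qed

section \<open>Powers close to 1 and close to 0\<close>

lemma one_minus_mult_le_power:
  fixes x :: real
  assumes "x \<in> {0..<1}"
  shows "1 - real n * (1 - x) \<le> x ^ n"
  using Bernoulli_inequality[of "x - 1" n] assms by (simp add: algebra_simps)

text \<open>Raise \<open>x \<le> exp (x - 1)\<close> to the power \<open>n\<close>. This controls
  exponents with \<open>n * (1 - x)\<close> large, Bernoulli's inequality those with it
  small.\<close>

lemma power_le_exp:
  fixes x :: real
  assumes "0 \<le> x"
  shows "x ^ n \<le> exp (- (real n * (1 - x)))"
proof -
  have "x ^ n \<le> exp (x - 1) ^ n"
    using exp_ge_add_one_self[of "x - 1"] assms by (intro power_mono) auto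
  also have "\<dots> = exp (- (real n * (1 - x)))"
    by (simp add: exp_of_nat_mult[symmetric] algebra_simps)
  finally show ?thesis .
qed

lemma exp_minus_le_obtain:
  fixes d :: real
  assumes "d > 0"
  obtains L :: real where "L > 0" "exp (- L) \<le> d"
proof
  \<comment> \<open>The maximum with 1 keeps the witness positive even when
    \<open>d \<ge> 1\<close>.\<close>
  have "exp (- max 1 (- ln d)) \<le> exp (ln d)" by simp
  also have "\<dots> = d" using assms by simp
  finally show "exp (- max 1 (- ln d)) \<le> d" .
qed simp

section \<open>The Abel limits\<close>

lemma eventually_abel_mean_ge:
  assumes e: "e > 0"
  shows "\<forall>\<^sub>F x in at 1 within {0..<1}. 3/4 - e \<le> abel_mean x"
proof -
  obtain L where L: "L > 0" "exp (- L) \<le> e / 2"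
    using exp_minus_le_obtain[of "e / 2"] e by auto
  \<comment> \<open>The threshold makes \<open>2 * L / (N + 1)\<close> at most \<open>e / 2\<close>;
    the successor ensures \<open>N \<ge> 1\<close>, hence \<open>k \<ge> 1\<close> below.\<close>
  obtain N0 :: nat where N0: "4 * L / e \<le> N0" using real_arch_simple by blast
  define N where "N = Suc N0"
  have N: "N \<ge> 1" "4 * L / e \<le> N" using N0 by (auto simp: N_def)
  have "1 - L / fact (Suc N) < 1" using L by simp
  then have "\<forall>\<^sub>F x in at 1 within {0..<1}. 1 - L / fact (Suc N) < x"
    by (intro order_tendstoD[OF tendsto_ident_at])
  moreover have "\<forall>\<^sub>F x in at 1 within {0..<1}. (x::real) \<in> {0..<1}"
    by (simp add: eventually_at_filter)
  ultimately show ?thesis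
  proof eventually_elim
    fix x :: real
    assume x0: "1 - L / fact (Suc N) < x" and x: "x \<in> {0..<1}"
    \<comment> \<open>Locating \<open>L / (1 - x)\<close> between factorials makes
      \<open>2 * fact k * (1 - x)\<close> small and \<open>fact (Suc (Suc k)) * (1 - x)\<close>
      larger than \<open>L\<close>.\<close>
    have "fact (Suc N) \<le> L / (1 - x)"
      using x0 x by (simp add: field_simps del: fact_Suc)
    then obtain k where k: "k \<ge> N" "L / (1 - x) < fact (Suc (Suc k))"
        "fact k \<le> L / (1 - x) / (N + 1)"
      using between_factorials by blast
    have "fact k * (2 * (1 - x)) \<le> L / (1 - x) / (N + 1) * (2 * (1 - x))"
      using k(3) x by (intro mult_right_mono) auto
    also have "\<dots> = 2 * L / (N + 1)" using x by (simp del: right_diff_distrib_numeral)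
    finally have "real (2 * fact k) * (1 - x) \<le> 2 * L / (N + 1)" by (simp add: mult_ac)
    also have "\<dots> \<le> e / 2"
      using N e by (simp add: field_simps)
    finally have 1: "1 - e / 2 \<le> x ^ (2 * fact k)"
      using one_minus_mult_le_power[OF x, of "2 * fact k"] by linarith
    have "x ^ fact (Suc (Suc k)) \<le> exp (- (real (fact (Suc (Suc k))) * (1 - x)))"
      using x by (intro power_le_exp) auto
    also have "\<dots> \<le> exp (- L)"
      using k(2) x by (simp add: field_simps del: fact_Suc)
    finally have 2: "x ^ fact (Suc (Suc k)) \<le> e / 2" using L by linarith
    \<comment> \<open>The two middle terms become \<open>y^2 - y\<close>; completing the square
      shows that they cost at most 1/4.\<close>
    define y where "y = x ^ fact (Suc k)"
    have y2: "x ^ (2 * fact (Suc k)) = y\<^sup>2"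
      by (simp add: y_def power_mult[symmetric] mult.commute)
    have "0 \<le> (y - 1/2)\<^sup>2" by simp
    then have "y - y\<^sup>2 \<le> 1/4" by (simp add: power2_eq_square algebra_simps)
    with 1 2 abel_mean_ge_2_steps[OF x, of k] k(1) N(1) show "3/4 - e \<le> abel_mean x"
      unfolding y2 y_def[symmetric] by linarith
  qed
qed

lemma filterlim_at_1_within:
  fixes x :: "nat \<Rightarrow> real"
  assumes "x \<longlonglongrightarrow> 1" and "\<forall>\<^sub>F k in sequentially. x k \<in> {0..<1}"
  shows "filterlim x (at 1 within {0..<1}) sequentially"
  using assms by (auto simp: filterlim_at elim: eventually_mono)

lemma tendsto_inverse_fact: "(\<lambda>k. 1 / fact k :: real) \<longlonglongrightarrow> 0"
  using filterlim_compose[OF lim_inverse_n' filterlim_fact_at_top] by simp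

lemma frequently_abel_mean_le: "\<exists>\<^sub>F x in at 1 within {0..<1}. abel_mean x \<le> 3/4"
proof -
  define x :: "nat \<Rightarrow> real" where "x k = (1/2) powr (1 / fact k)" for k
  have x01: "x k \<in> {0..<1}" for k
    using ln_less_zero[of "1/2"] by (simp add: x_def powr_def divide_neg_pos)
  have "x \<longlonglongrightarrow> (1/2) powr 0"
    unfolding x_def by (intro tendsto_powr tendsto_inverse_fact) auto
  then have lim: "filterlim x (at 1 within {0..<1}) sequentially"
    using x01 by (intro filterlim_at_1_within) auto
  have "abel_mean (x k) \<le> 3/4" if "k \<ge> 1" for k
  proof -
    have half: "x k ^ fact k = 1/2"
      by (simp add: x_def powr_realpow[symmetric] powr_powr)
    have "x k ^ (2 * fact k) = (x k ^ fact k)\<^sup>2"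
      by (simp add: power_mult[symmetric] mult.commute)
    then have "x k ^ (2 * fact k) = 1/4"
      unfolding half by (simp add: power2_eq_square)
    with half abel_mean_le_step[OF x01[of k] that] show ?thesis by simp
  qed
  then have "\<forall>\<^sub>F k in sequentially. abel_mean (x k) \<le> 3/4"
    using eventually_ge_at_top[of 1] by (rule eventually_mono[rotated])
  with lim show ?thesis by (rule frequently_filterlim_sequentially)
qed

lemma frequently_abel_mean_ge:
  assumes e: "e > 0"
  shows "\<exists>\<^sub>F x in at 1 within {0..<1}. 1 - e \<le> abel_mean x"
proof -
  obtain L where L: "L > 0" "exp (- L) \<le> e / 2"
    using exp_minus_le_obtain[of "e / 2"] e by auto
  \<comment> \<open>Here \<open>fact (Suc k) * (1 - x k) = L\<close> exactly, while
    \<open>2 * fact k * (1 - x k) = 2 * L / (k + 1)\<close> tends to 0. Positivity of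
    \<open>x k\<close> holds only eventually, since \<open>L\<close> may be large.\<close>
  define x where "x k = 1 - L * (1 / fact (Suc k))" for k
  have inv: "(\<lambda>k. 1 / fact (Suc k) :: real) \<longlonglongrightarrow> 0"
    using tendsto_inverse_fact by (rule LIMSEQ_Suc)
  have "x \<longlonglongrightarrow> 1 - L * 0"
    unfolding x_def by (intro tendsto_intros inv)
  then have lim: "x \<longlonglongrightarrow> 1" by simp
  then have "\<forall>\<^sub>F k in sequentially. 0 < x k" by (rule order_tendstoD) simp
  then have x01: "\<forall>\<^sub>F k in sequentially. x k \<in> {0..<1}"
    by (rule eventually_mono) (use L in \<open>auto simp: x_def simp del: fact_Suc\<close>)
  obtain N :: nat where N: "4 * L / e \<le> N" using real_arch_simple by blast
  have "\<forall>\<^sub>F k in sequentially. 1 - e \<le> abel_mean (x k)"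
    using x01 eventually_ge_at_top[of "Suc N"]
  proof eventually_elim
    fix k assume x: "x k \<in> {0..<1}" and k: "Suc N \<le> k"
    have "real (2 * fact k) * (1 - x k) = 2 * L / (k + 1)"
      by (simp add: x_def divide_simps)
    also have "\<dots> \<le> e / 2"
    proof -
      have "4 * L / e \<le> k + 1" using N k by linarith
      then show ?thesis using e by (simp add: field_simps)
    qed
    finally have 1: "1 - e / 2 \<le> x k ^ (2 * fact k)"
      using one_minus_mult_le_power[OF x, of "2 * fact k"] by linarith
    have "x k ^ fact (Suc k) \<le> exp (- (real (fact (Suc k)) * (1 - x k)))"
      using x by (intro power_le_exp) auto
    also have "\<dots> = exp (- L)"
      by (simp add: x_def del: fact_Suc)
    finally have 2: "x k ^ fact (Suc k) \<le> e / 2" using L by linarith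
    with 1 abel_mean_ge_1_step[OF x, of k] k show "1 - e \<le> abel_mean (x k)" by linarith
  qed
  with filterlim_at_1_within[OF lim x01] show ?thesis
    by (rule frequently_filterlim_sequentially)
qed

section \<open>The Cesaro limits\<close>

definition cesaro_mean :: "nat \<Rightarrow> real" where
  "cesaro_mean n = 1 / real n * (\<Sum>i<n. factorial_block_seq i)"

lemma eventually_cesaro_mean_ge:
  assumes e: "e > 0"
  shows "\<forall>\<^sub>F n in sequentially. 1/2 - e \<le> cesaro_mean n"
proof -
  obtain N0 :: nat where N0: "2 / e \<le> N0" using real_arch_simple by blast
  define N where "N = Suc N0"
  have N: "N \<ge> 1" "2 / e \<le> N" using N0 by (auto simp: N_def)
  show ?thesis using eventually_ge_at_top[of "fact (Suc N)"]
  proof eventually_elim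
    fix n :: nat assume n: "fact (Suc N) \<le> n"
    then have "fact (Suc N) \<le> real n"
      by (metis of_nat_fact of_nat_le_iff)
    then obtain k where k: "k \<ge> N" "fact (Suc k) \<le> real n" "real n < fact (Suc (Suc k))"
        "fact k \<le> real n / (N + 1)"
      using between_factorials by blast
    define a b m where "a = (fact k :: nat)" and "b = (fact (Suc k) :: nat)"
      and "m = (fact (Suc (Suc k)) :: nat)"
    have bn: "b \<le> n" "n < m"
      using k unfolding b_def m_def by (metis of_nat_fact of_nat_le_iff of_nat_less_iff)+
    have ab: "2 * a \<le> b" using double_fact_le[of k] k N by (simp add: a_def b_def)
    have "(\<Sum>i<n. of_bool (2 * a \<le> i) - of_bool (b \<le> i) + of_bool (2 * b \<le> i) - of_bool (m \<le> i))
        \<le> (\<Sum>i<n. factorial_block_seq i)"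
      using k N unfolding a_def b_def m_def
      by (intro sum_mono factorial_block_seq_ge_2_steps) auto
    then have "real (n - 2 * a) - real (n - b) + real (n - 2 * b) - real (n - m)
        \<le> (\<Sum>i<n. factorial_block_seq i)"
      by (simp only: sum.distrib sum_subtractf sum_of_bool_le)
    \<comment> \<open>Here \<open>n - m\<close> is 0. If \<open>n \<le> 2 * b\<close>, the count of
      ones is \<open>b - 2 * a\<close> with \<open>b \<ge> n / 2\<close>; otherwise it is
      \<open>n - b - 2 * a\<close> with \<open>b < n / 2\<close>.\<close>
    moreover have "real n / 2 - 2 * real a
        \<le> real (n - 2 * a) - real (n - b) + real (n - 2 * b) - real (n - m)"
      using bn ab by linarith
    moreover have "2 * real a \<le> e * n"
    proof -
      have "2 * real a \<le> real n * (2 / (N + 1))" using k(4) by (simp add: a_def field_simps)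
      also have "\<dots> \<le> real n * e" using N e by (intro mult_left_mono) (auto simp: field_simps)
      finally show ?thesis by (simp add: mult.commute)
    qed
    ultimately have le: "real n / 2 - e * n \<le> (\<Sum>i<n. factorial_block_seq i)" by linarith
    have "n > 0" using n fact_gt_zero[of "Suc N", where 'a = nat] by linarith
    with le show "1/2 - e \<le> cesaro_mean n" by (simp add: cesaro_mean_def field_simps)
  qed
qed

lemma cesaro_mean_le_1: "cesaro_mean n \<le> 1"
proof -
  have "(\<Sum>i<n. factorial_block_seq i) \<le> (\<Sum>i<n. 1)"
    by (intro sum_mono factorial_block_seq_le_1)
  \<comment> \<open>For \<open>n = 0\<close> the mean is 0, by division by zero.\<close>
  then show ?thesis by (cases "n = 0") (simp_all add: cesaro_mean_def field_simps)
qed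

text \<open>At the end \<open>2 * fact k\<close> of a zero block, that block makes up half of all
  indices.\<close>

lemma frequently_cesaro_mean_le: "\<exists>\<^sub>F n in sequentially. cesaro_mean n \<le> 1/2"
proof (rule frequently_filterlim_sequentially)
  show "filterlim (\<lambda>k. 2 * fact k :: nat) at_top sequentially"
    by (rule filterlim_at_top_mono[OF filterlim_fact_at_top]) simp
  show "\<forall>\<^sub>F k in sequentially. cesaro_mean (2 * fact k) \<le> 1/2"
    using eventually_ge_at_top[of 1]
  proof eventually_elim
    fix k :: nat assume k: "1 \<le> k"
    define n where "n = (fact k :: nat)"
    have "(\<Sum>i<2 * n. factorial_block_seq i)
        \<le> (\<Sum>i<2 * n. 1 - of_bool (n \<le> i) + of_bool (2 * n \<le> i))"
      using k unfolding n_def by (intro sum_mono factorial_block_seq_le_step)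
    also have "\<dots> = real n"
      by (simp only: sum.distrib sum_subtractf sum_of_bool_le) simp
    finally have "(\<Sum>i<2 * n. factorial_block_seq i) \<le> real n" .
    moreover have "n > 0" by (simp add: n_def)
    ultimately show "cesaro_mean (2 * fact k) \<le> 1/2"
      unfolding cesaro_mean_def n_def[symmetric] by (simp add: field_simps)
  qed
qed

text \<open>Just before the zero block at \<open>fact (Suc k)\<close>, only indices below
  \<open>2 * fact k\<close> can carry zeros, a fraction of at most
  \<open>2 / (k + 1)\<close>.\<close>

lemma frequently_cesaro_mean_ge:
  assumes e: "e > 0"
  shows "\<exists>\<^sub>F n in sequentially. 1 - e \<le> cesaro_mean n"
proof (rule frequently_filterlim_sequentially)
  show "filterlim (\<lambda>k. fact (Suc k) :: nat) at_top sequentially"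
    using filterlim_fact_at_top filterlim_Suc by (rule filterlim_compose)
  obtain N :: nat where N: "2 / e \<le> N" using real_arch_simple by blast
  show "\<forall>\<^sub>F k in sequentially. 1 - e \<le> cesaro_mean (fact (Suc k))"
    using eventually_ge_at_top[of "Suc N"]
  proof eventually_elim
    fix k assume k: "Suc N \<le> k"
    define a n where "a = (fact k :: nat)" and "n = (fact (Suc k) :: nat)"
    have "(\<Sum>i<n. of_bool (2 * a \<le> i) - of_bool (n \<le> i)) \<le> (\<Sum>i<n. factorial_block_seq i)"
      using k unfolding a_def n_def by (intro sum_mono factorial_block_seq_ge_1_step) auto
    then have "real (n - 2 * a) - real (n - n) \<le> (\<Sum>i<n. factorial_block_seq i)"
      by (simp only: sum_subtractf sum_of_bool_le)
    then have "real n - 2 * real a \<le> (\<Sum>i<n. factorial_block_seq i)" by linarith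
    moreover have "2 * real a \<le> e * n"
    proof -
      have "2 / e \<le> k + 1" using N k by linarith
      then have "2 \<le> e * (k + 1)" using e by (simp add: field_simps)
      then have "2 * real a \<le> e * (k + 1) * real a" by (rule mult_right_mono) simp
      then show ?thesis by (simp add: n_def a_def mult.assoc algebra_simps)
    qed
    moreover have "n > 0" by (simp add: n_def)
    ultimately show "1 - e \<le> cesaro_mean (fact (Suc k))"
      unfolding cesaro_mean_def n_def[symmetric] by (simp add: field_simps)
  qed
qed

theorem proposition2:
  shows "lower_cesaro factorial_block_seq = ereal (1/2)
    \<and> lower_abel factorial_block_seq = ereal (3/4)
    \<and> upper_cesaro factorial_block_seq = 1
    \<and> upper_abel factorial_block_seq = 1
    \<and> lower_cesaro factorial_block_seq < lower_abel factorial_block_seq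
    \<and> lower_abel factorial_block_seq < upper_abel factorial_block_seq
    \<and> upper_abel factorial_block_seq = upper_cesaro factorial_block_seq"
proof -
  have lc: "lower_cesaro factorial_block_seq = ereal (1/2)"
    unfolding lower_cesaro_def cesaro_mean_def[symmetric]
    by (intro Liminf_ereal_eqI eventually_cesaro_mean_ge
        frequently_elim1[OF frequently_cesaro_mean_le]) auto
  have uc: "upper_cesaro factorial_block_seq = ereal 1"
    unfolding upper_cesaro_def cesaro_mean_def[symmetric]
    by (intro Limsup_ereal_eqI frequently_cesaro_mean_ge always_eventually allI
        order_trans[OF cesaro_mean_le_1]) auto
  have la: "lower_abel factorial_block_seq = ereal (3/4)"
    unfolding lower_abel_def abel_mean_def[symmetric]
    by (intro Liminf_ereal_eqI eventually_abel_mean_ge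
        frequently_elim1[OF frequently_abel_mean_le]) auto
  have ua: "upper_abel factorial_block_seq = ereal 1"
    unfolding upper_abel_def abel_mean_def[symmetric]
  proof (rule Limsup_ereal_eqI[OF _ frequently_abel_mean_ge])
    fix e :: real assume "e > 0"
    \<comment> \<open>The bound by 1 is available only on \<open>{0..<1}\<close>, so membership is
      first extracted from the filter.\<close>
    have "\<forall>\<^sub>F x in at 1 within {0..<1}. (x::real) \<in> {0..<1}"
      by (simp add: eventually_at_filter)
    then show "\<forall>\<^sub>F x in at 1 within {0..<1}. abel_mean x \<le> 1 + e"
      by (rule eventually_mono) (use abel_mean_le_1 \<open>e > 0\<close> in force)
  qed
  show ?thesis
    unfolding lc uc la ua by (simp add: one_ereal_def)
qed

end
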